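(* Let $\mathcal{H}$ be a separable real Hilbert space, let $T$ be a bounded linear operator on $\mathcal{H}$, and let $U$ be a unitary operator on $\mathcal{H}$ such that $TU=UT$. Let $\mathcal{B}=\{e_n\}_n$ be an orthonormal basis of $\mathcal{H}$. Then $T$ is a P-operator relative to $\mathcal{B}=\{e_n\}_n$ if and only if $T$ is a P-operator relative to the orthonormal basis $\mathcal{B}'=\{Ue_n\}_n$ of $\mathcal{H}$.
   Context: $\mathcal{H}$ is a separable real Hilbert space with inner product $\langle\cdot,\cdot\rangle$; orthonormal bases are indexed by the natural numbers $n=1,2,3,\ldots$. An operator on $\mathcal{H}$ is a linear map from $\mathcal{H}$ into itself. A unitary operator on $\mathcal{H}$ is a bounded linear operator $U$ with $U^*U=UU^*=I$. Definition (P-operator). Let $\{f_n\}_n$ be an orthonormal basis of $\mathcal{H}$. A bounded linear operator $T$ on $\mathcal{H}$ is a P-operator relative to $\{f_n\}_n$ if, for every $x\in\mathcal{H}$, whenever $\langle x,f_n\rangle\langle Tx,f_n\rangle\le 0$ for all $n$, it follows that $x=0$. *)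

theory Defs
  imports "HOL-Analysis.Analysis"
begin

definition orthonormal_basis :: "(nat \<Rightarrow> 'a::real_inner) \<Rightarrow> bool" where
  "orthonormal_basis f \<longleftrightarrow>
     (\<forall>m n. f m \<bullet> f n = (if m = n then 1 else 0)) \<and> closure (span (range f)) = UNIV"

text \<open>The constant \<open>adjoint\<close> picks some map satisfying the defining identity of the adjoint.
  For a bounded linear map on a complete space such a map exists (Riesz) and is unique, so it is
  the usual Hilbert space adjoint.\<close>

definition unitary_operator :: "('a::{real_inner, complete_space} \<Rightarrow> 'a) \<Rightarrow> bool" where
  "unitary_operator U \<longleftrightarrow>
     bounded_linear U \<and> adjoint U \<circ> U = id \<and> U \<circ> adjoint U = id"

definition P_operator :: "('a::{real_inner, complete_space} \<Rightarrow> 'a) \<Rightarrow> (nat \<Rightarrow> 'a) \<Rightarrow> bool" where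
  "P_operator T f \<longleftrightarrow>
     bounded_linear T \<and> orthonormal_basis f \<and>
     (\<forall>x. (\<forall>n. (x \<bullet> f n) * (T x \<bullet> f n) \<le> 0) \<longrightarrow> x = 0)"

end

theory Submission
  imports Defs
begin

text \<open>A unitary \<open>U\<close> preserves inner products, and \<open>T\<close> commutes with
  it, so the products that define the P-property of \<open>T\<close> at \<open>U y\<close> relative
  to the vectors \<open>U (e n)\<close> equal those at \<open>y\<close> relative to the
  \<open>e n\<close>. Since \<open>U\<close> is surjective and kills only 0, the two P-properties
  coincide. Because \<open>adjoint\<close> is a choice operator,
  \<open>unitary_operator_inner\<close> rests on the existence of an adjoint
  (\<open>adjoint_bounded_linear\<close>), which comes from \<open>riesz_representation\<close>.
  That \<open>U\<close> carries bases to bases is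
  \<open>orthonormal_basis_unitary_image\<close>.\<close>

text \<open>This form of the parallelogram law measures the strict convexity of the squared norm; it
  forces near-minimizers of the energy to be close together.\<close>

lemma parallelogram_midpoint:
  fixes x y :: "'a::real_inner"
  shows "(norm x)\<^sup>2 + (norm y)\<^sup>2 - 2 * (norm ((1/2) *\<^sub>R (x + y)))\<^sup>2 = (norm (x - y))\<^sup>2 / 2"
  unfolding power2_norm_eq_inner
  by (simp add: inner_add_left inner_add_right inner_diff_left inner_diff_right inner_commute field_simps)

text \<open>The representing vector is the minimizer of the energy \<open>\<parallel>x\<parallel>\<^sup>2 - 2 \<phi> x\<close>.\<close>

lemma riesz_representation:
  fixes \<phi> :: "'a::{real_inner, complete_space} \<Rightarrow> real"
  assumes "bounded_linear \<phi>"
  shows "\<exists>a. \<forall>x. \<phi> x = a \<bullet> x"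
proof -
  interpret \<phi>: bounded_linear \<phi> by fact
  define J where "J x = (norm x)\<^sup>2 - 2 * \<phi> x" for x
  define m where "m = Inf (range J)"
  obtain K where K: "\<And>x. norm (\<phi> x) \<le> norm x * K"
    using \<phi>.bounded by blast
  \<comment> \<open>Completing the square: the energy is at least
    \<open>(norm x - K)\<^sup>2 - K\<^sup>2\<close>.\<close>
  have "- K\<^sup>2 \<le> J x" for x
  proof -
    have "\<phi> x \<le> norm x * K" using K[of x] by simp
    moreover have "0 \<le> (norm x - K)\<^sup>2" by simp
    ultimately show ?thesis by (simp add: J_def power2_diff)
  qed
  then have "bdd_below (range J)" by (auto simp: bdd_below_def)
  then have m_le: "m \<le> J x" for x
    unfolding m_def by (intro cInf_lower) auto
  have "\<exists>x. J x < m + 1 / real (Suc n)" for n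
    using cInf_lessD[of "range J" "m + 1 / real (Suc n)"] unfolding m_def by fastforce
  then obtain X where X: "\<And>n. J (X n) < m + 1 / real (Suc n)" by metis
  \<comment> \<open>The linear part cancels in \<open>J x + J y\<close> minus twice the energy of
    the midpoint, and that energy is at least \<open>m\<close>.\<close>
  have dist_le: "(norm (x - y))\<^sup>2 \<le> 2 * (J x + J y - 2 * m)" for x y
    using m_le[of "(1/2) *\<^sub>R (x + y)"] parallelogram_midpoint[of x y]
    unfolding J_def \<phi>.scaleR \<phi>.add real_scaleR_def by argo
  have "Cauchy X"
  proof (rule CauchyI)
    fix \<epsilon> :: real assume "\<epsilon> > 0"
    \<comment> \<open>Two excesses below a quarter of \<open>\<epsilon>\<^sup>2\<close>, doubled by
      \<open>dist_le\<close>, stay below \<open>\<epsilon>\<^sup>2\<close>.\<close>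
    then obtain N where N: "1 / real (Suc N) < \<epsilon>\<^sup>2 / 4"
      using nat_approx_posE[of "\<epsilon>\<^sup>2 / 4"] by auto
    have "norm (X i - X j) < \<epsilon>" if "N \<le> i" "N \<le> j" for i j
    proof -
      have "J (X k) < m + \<epsilon>\<^sup>2 / 4" if "N \<le> k" for k
      proof -
        have "1 / real (Suc k) \<le> 1 / real (Suc N)" using that by (simp add: frac_le)
        then show ?thesis using X[of k] N by linarith
      qed
      from this[OF \<open>N \<le> i\<close>] this[OF \<open>N \<le> j\<close>]
      have "(norm (X i - X j))\<^sup>2 < \<epsilon>\<^sup>2" using dist_le[of "X i" "X j"] by argo
      then show ?thesis using \<open>\<epsilon> > 0\<close> by (simp add: power_less_imp_less_base)
    qed
    then show "\<exists>M. \<forall>i\<ge>M. \<forall>j\<ge>M. norm (X i - X j) < \<epsilon>" by blast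
  qed
  then obtain a where a: "X \<longlonglongrightarrow> a"
    using Cauchy_convergent convergent_def by blast
  have "(\<lambda>n. J (X n)) \<longlonglongrightarrow> J a"
    unfolding J_def by (intro tendsto_intros a \<phi>.tendsto)
  moreover have "(\<lambda>n. m + 1 / real (Suc n)) \<longlonglongrightarrow> m + 0"
    by (intro tendsto_intros LIMSEQ_Suc lim_1_over_n)
  ultimately have "J a \<le> m"
    using X by (intro LIMSEQ_le[where Y = "\<lambda>n. m + 1 / real (Suc n)"]) (auto intro: less_imp_le)
  have "\<phi> v = a \<bullet> v" for v
  proof (cases "v = 0")
    case False
    define c where "c = a \<bullet> v - \<phi> v"
    \<comment> \<open>This \<open>t\<close> minimizes the quadratic giving the energy along the line
      through \<open>a\<close> in direction \<open>v\<close>; minimality of \<open>a\<close> then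
      forces \<open>c = 0\<close>.\<close>
    define t where "t = - c / (v \<bullet> v)"
    have vv: "v \<bullet> v > 0" using False by simp
    have "J (a + t *\<^sub>R v) = J a + 2 * t * c + t * t * (v \<bullet> v)"
      unfolding J_def c_def power2_norm_eq_inner
      by (simp add: \<phi>.scaleR \<phi>.add inner_commute algebra_simps)
    also have "\<dots> = J a - c\<^sup>2 / (v \<bullet> v)"
      using vv by (simp add: t_def power2_eq_square field_simps)
    finally have "c\<^sup>2 / (v \<bullet> v) \<le> 0"
      using m_le[of "a + t *\<^sub>R v"] \<open>J a \<le> m\<close> by linarith
    then have "c = 0" using vv by (simp add: divide_le_0_iff)
    then show ?thesis by (simp add: c_def)
  qed simp
  then show ?thesis by blast
qed

text \<open>Riesz, applied to \<open>U x \<bullet> z\<close> as a functional of \<open>x\<close> for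
  each \<open>z\<close>, supplies a witness for the choice in \<open>adjoint\<close>.\<close>

lemma adjoint_bounded_linear:
  fixes U :: "'a::{real_inner, complete_space} \<Rightarrow> 'b::real_inner"
  assumes "bounded_linear U"
  shows "U x \<bullet> y = x \<bullet> adjoint U y"
proof -
  have "\<exists>a. \<forall>x. U x \<bullet> z = a \<bullet> x" for z
    by (intro riesz_representation bounded_linear_inner_left_comp assms)
  then obtain V where "\<And>x z. U x \<bullet> z = V z \<bullet> x" by metis
  then have "\<exists>V. \<forall>x z. U x \<bullet> z = x \<bullet> V z" by (metis inner_commute)
  then have "\<forall>x z. U x \<bullet> z = x \<bullet> adjoint U z"
    unfolding adjoint_def by (rule someI_ex)
  then show ?thesis by blast
qed

lemma unitary_operator_inner:
  assumes "unitary_operator U"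
  shows "U x \<bullet> U y = x \<bullet> y"
  using assms adjoint_bounded_linear[of U x "U y"]
  by (simp add: unitary_operator_def pointfree_idE)

lemma unitary_operator_surj:
  assumes "unitary_operator U"
  shows "surj U"
  using assms by (intro surjI[where f = "adjoint U"]) (simp add: unitary_operator_def pointfree_idE)

lemma orthonormal_basis_unitary_image:
  assumes "unitary_operator U" and "orthonormal_basis e"
  shows "orthonormal_basis (\<lambda>n. U (e n))"
proof -
  have lin: "bounded_linear U" using assms(1) by (simp add: unitary_operator_def)
  \<comment> \<open>Density transfers: surjectivity makes the image of the closure everything, and
    continuity places it inside the closure of the image.\<close>
  have "UNIV = U ` closure (span (range e))"
    using assms unitary_operator_surj[OF assms(1)] by (simp add: orthonormal_basis_def)
  also have "\<dots> \<subseteq> closure (U ` span (range e))"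
    by (rule closure_bounded_linear_image_subset[OF lin])
  also have "U ` span (range e) = span (range (\<lambda>n. U (e n)))"
    using linear_span_image[OF bounded_linear.linear[OF lin], of "range e"] by (simp add: image_image)
  finally show ?thesis
    using assms by (auto simp: orthonormal_basis_def unitary_operator_inner)
qed

theorem theorem2p6:
  fixes T U :: "'a::{real_inner, complete_space} \<Rightarrow> 'a"
    and e :: "nat \<Rightarrow> 'a"
  assumes "separable_space (euclidean :: 'a topology)"
    and "bounded_linear T"
    and "unitary_operator U"
    and "T \<circ> U = U \<circ> T"
    and "orthonormal_basis e"
  shows "orthonormal_basis (\<lambda>n. U (e n)) \<and>
    (P_operator T e \<longleftrightarrow> P_operator T (\<lambda>n. U (e n)))"
proof -
  let ?P = "\<lambda>f x. (\<forall>n. (x \<bullet> f n) * (T x \<bullet> f n) \<le> 0) \<longrightarrow> x = 0"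
  have basis: "orthonormal_basis (\<lambda>n. U (e n))"
    by (rule orthonormal_basis_unitary_image[OF assms(3,5)])
  have comm: "T (U y) = U (T y)" for y
    using assms(4) by (metis comp_apply)
  have zero: "U y = 0 \<longleftrightarrow> y = 0" for y
    using unitary_operator_inner[OF assms(3), of y y] by (metis inner_eq_zero_iff)
  \<comment> \<open>Substituting \<open>x = U y\<close> reaches every vector, as \<open>U\<close> is
    onto.\<close>
  have "(\<forall>x\<in>range U. ?P (\<lambda>n. U (e n)) x) \<longleftrightarrow> (\<forall>y. ?P (\<lambda>n. U (e n)) (U y))"
    by blast
  also have "\<dots> \<longleftrightarrow> (\<forall>y. ?P e y)"
    by (simp add: comm zero unitary_operator_inner[OF assms(3)])
  finally show ?thesis
    using basis assms(2,5) unitary_operator_surj[OF assms(3)] by (simp add: P_operator_def)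
qed

end
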